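(* Let $R$ be a skew partition. Any two complete executions of downward jeu de taquin on $R$ (possibly using different choices of the points $H$ at each slide) produce the same labelled finite lower ideal of $(\mathbb P^2,\preceq)$; that is, the partition obtained by downward jeu de taquin from a skew partition is independent of the choices made during the algorithm.
   Context: $A$ is a finite totally ordered alphabet, $\mathbb P=\{1,2,\ldots\}$. On $\mathbb P^2$ consider the partial order $\preceq$ generated by the covering relations $(1,y)\prec(1,y+1)$ and $(x,y)\prec(x+1,y)$ for all $x,y\in\mathbb P$. An ideal is a finite lower ideal of $(\mathbb P^2,\preceq)$. A skew ideal is a set $S=I\setminus J$ with $J\subseteq I$ ideals. An $A$-labelling of a finite subset $X\subseteq\mathbb P^2$ is an injective map from $X$ to $A$ which is strictly increasing for $\preceq$ restricted to $X$ (if $p\prec q$ then label$(p)<$ label$(q)$). A skew partition is an $A$-labelling of a skew ideal (its shape); a partition is an $A$-labelling of an ideal. A skew partition with a hole is a skew ideal $S=I\setminus J$ together with a point $H\in S$ (the hole) and an $A$-labelling of $S\setminus\{H\}$; $H$ is an upper corner if $I\setminus\{H\}$ is an ideal. Downward move on a skew partition with a hole: if $H$ is an upper corner, remove $H$ from the shape, obtaining a skew partition without hole. Otherwise, consider the points of $S$ covering $H$ in $\preceq$ (there are one or two): if there is one, $K$, move the label of $K$ to $H$ and make $K$ the new hole; if there are two, $K$ and $L$, with labels $x<y$, move $x$ from $K$ to $H$ and make $K$ the new hole. Downward slide on a skew partition of shape $I\setminus J$ with $J\neq\emptyset$: choose a point $H$ maximal in $J$ (for $\preceq$), view $H$ as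 a hole of the shape $(I\setminus J)\cup\{H\}$, and apply downward moves until no hole remains; the resulting shape is of the form $I'\setminus(J\setminus\{H\})$. Downward jeu de taquin: apply downward slides repeatedly until the shape is an ideal (i.e. a partition is obtained). *)

theory Defs imports Main begin

type_synonym point = "nat \<times> nat"

definition grid :: "point set" where
  "grid = {(x, y). 1 \<le> x \<and> 1 \<le> y}"

text \<open>The first coordinate varies horizontally; vertical steps exist only in the column
  \<open>x = 1\<close>, so the order below is not the product order.\<close>

inductive covered_by :: "point \<Rightarrow> point \<Rightarrow> bool"  (infix "\<lessdot>" 50) where
  up: "1 \<le> y \<Longrightarrow> (1, y) \<lessdot> (1, y + 1)"
| right: "1 \<le> x \<Longrightarrow> 1 \<le> y \<Longrightarrow> (x, y) \<lessdot> (x + 1, y)"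

definition point_le :: "point \<Rightarrow> point \<Rightarrow> bool"  (infix "\<preceq>" 50) where
  "p \<preceq> q \<longleftrightarrow> covered_by\<^sup>*\<^sup>* p q"

definition point_less :: "point \<Rightarrow> point \<Rightarrow> bool"  (infix "\<prec>" 50) where
  "p \<prec> q \<longleftrightarrow> p \<preceq> q \<and> p \<noteq> q"

definition ideal :: "point set \<Rightarrow> bool" where
  "ideal I \<longleftrightarrow> finite I \<and> I \<subseteq> grid \<and> (\<forall>q\<in>I. \<forall>p. p \<preceq> q \<longrightarrow> p \<in> I)"

definition skew_ideal :: "point set \<Rightarrow> bool" where
  "skew_ideal S \<longleftrightarrow> (\<exists>I J. ideal I \<and> ideal J \<and> J \<subseteq> I \<and> S = I - J)"

text \<open>A labelled set of points is a partial function on points; its domain is the shape.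
  Equality of such maps is thus equality of both shape and labels.\<close>

definition labelling :: "'a::linorder set \<Rightarrow> point set \<Rightarrow> (point \<rightharpoonup> 'a) \<Rightarrow> bool" where
  "labelling A X f \<longleftrightarrow>
     finite X \<and> X \<subseteq> grid \<and> dom f = X \<and> ran f \<subseteq> A \<and> inj_on f X \<and>
     (\<forall>p\<in>X. \<forall>q\<in>X. p \<prec> q \<longrightarrow> the (f p) < the (f q))"

definition skew_partition :: "'a::linorder set \<Rightarrow> (point \<rightharpoonup> 'a) \<Rightarrow> bool" where
  "skew_partition A R \<longleftrightarrow> skew_ideal (dom R) \<and> labelling A (dom R) R"

definition is_partition :: "'a::linorder set \<Rightarrow> (point \<rightharpoonup> 'a) \<Rightarrow> bool" where
  "is_partition A P \<longleftrightarrow> ideal (dom P) \<and> labelling A (dom P) P"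

definition upper_corner :: "point set \<Rightarrow> point \<Rightarrow> bool" where
  "upper_corner I H \<longleftrightarrow> ideal (I - {H})"

definition covers_in :: "point set \<Rightarrow> point \<Rightarrow> point set" where
  "covers_in S H = {K \<in> S. H \<lessdot> K}"

text \<open>A skew partition of shape \<open>S = I - J\<close> with hole \<open>H\<close> is represented by the pair
  \<open>(H, f)\<close>, where \<open>f\<close> labels \<open>S - {H}\<close>. The relation below is a downward move at a hole that is
  not an upper corner. At an upper corner the move only deletes \<open>H\<close> from the shape; as \<open>H\<close> is
  not in the domain of \<open>f\<close>, the result is \<open>f\<close> itself, now labelling \<open>(I - {H}) - J\<close>.\<close>

inductive downward_move ::
  "point set \<Rightarrow> point set \<Rightarrow> point \<times> (point \<rightharpoonup> 'a::linorder) \<Rightarrow> point \<times> (point \<rightharpoonup> 'a) \<Rightarrow> bool"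
  for I J where
  one: "\<not> upper_corner I H \<Longrightarrow> covers_in (I - J) H = {K} \<Longrightarrow>
    downward_move I J (H, f) (K, f(H := f K, K := None))"
| two: "\<not> upper_corner I H \<Longrightarrow> covers_in (I - J) H = {K, L} \<Longrightarrow> K \<noteq> L \<Longrightarrow>
    f K = Some x \<Longrightarrow> f L = Some y \<Longrightarrow> x < y \<Longrightarrow>
    downward_move I J (H, f) (K, f(H := Some x, K := None))"

definition maximal_in :: "point set \<Rightarrow> point \<Rightarrow> bool" where
  "maximal_in J H \<longleftrightarrow> H \<in> J \<and> (\<forall>q\<in>J. \<not> H \<prec> q)"

text \<open>A skew ideal is a set and may be written as \<open>I - J\<close> in several ways; a slide may use any
  of them.\<close>

definition downward_slide :: "(point \<rightharpoonup> 'a::linorder) \<Rightarrow> (point \<rightharpoonup> 'a) \<Rightarrow> bool" where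
  "downward_slide R R' \<longleftrightarrow>
     (\<exists>I J H K. ideal I \<and> ideal J \<and> J \<subseteq> I \<and> dom R = I - J \<and> J \<noteq> {} \<and> maximal_in J H \<and>
        (downward_move I (J - {H}))\<^sup>*\<^sup>* (H, R) (K, R') \<and> upper_corner I K)"

text \<open>\<open>downward_jdt R P\<close>: some complete execution of downward jeu de taquin leads from \<open>R\<close>
  to \<open>P\<close>.\<close>

inductive downward_jdt :: "(point \<rightharpoonup> 'a::linorder) \<Rightarrow> (point \<rightharpoonup> 'a) \<Rightarrow> bool" where
  stop: "ideal (dom P) \<Longrightarrow> downward_jdt P P"
| slide: "\<not> ideal (dom R) \<Longrightarrow> downward_slide R R' \<Longrightarrow> downward_jdt R' P \<Longrightarrow> downward_jdt R P"

end

(* In the order on the grid every point covers at most one other point, so the order is a rooted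
   tree: two incomparable points have disjoint up-sets. A slide starting at H only reads and
   changes labels in the up-set of H, and it is determined by H. The maximal points of J
   are pairwise incomparable, so slides at two of them commute. This is the diamond property, and
   partitions are normal forms. *)
theory Submission
  imports Defs "HOL-Library.Confluence"
begin

section \<open>The tree order\<close>

lemma point_le_refl [simp]: "p \<preceq> p"
  by (simp add: point_le_def)

lemma point_le_trans: "p \<preceq> q \<Longrightarrow> q \<preceq> r \<Longrightarrow> p \<preceq> r"
  unfolding point_le_def by (rule rtranclp_trans)

lemma covered_by_imp_le: "p \<lessdot> q \<Longrightarrow> p \<preceq> q"
  by (simp add: point_le_def)

lemma covered_by_sum: "p \<lessdot> q \<Longrightarrow> fst q + snd q = Suc (fst p + snd p)"
  by (erule covered_by.cases) auto

lemma point_le_coords: "p \<preceq> q \<Longrightarrow> fst p \<le> fst q \<and> snd p \<le> snd q"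
  unfolding point_le_def
  by (induction rule: rtranclp_induct) (auto elim!: covered_by.cases)

lemma point_le_antisym: "p \<preceq> q \<Longrightarrow> q \<preceq> p \<Longrightarrow> p = q"
  by (meson order_antisym point_le_coords prod_eqI)

lemma covered_by_imp_less: "p \<lessdot> q \<Longrightarrow> p \<prec> q"
  using covered_by_sum covered_by_imp_le by (fastforce simp: point_less_def)

lemma point_less_imp_cover: "p \<prec> q \<Longrightarrow> \<exists>r. p \<lessdot> r \<and> r \<preceq> q"
  unfolding point_less_def point_le_def by (metis converse_rtranclpE)

text \<open>Vertical covers end in the column \<open>x = 1\<close>, horizontal ones at first
  coordinate at least 2, so no point is reached both ways.\<close>

lemma covered_by_unique: "p \<lessdot> r \<Longrightarrow> q \<lessdot> r \<Longrightarrow> p = q"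
  by (auto elim!: covered_by.cases)

text \<open>Walking down from \<open>r\<close> is deterministic, so of two walks one continues the
  other. The contrapositive makes the up-sets of incomparable points disjoint.\<close>

lemma point_le_linear_below:
  assumes "p \<preceq> r" "q \<preceq> r"
  shows "p \<preceq> q \<or> q \<preceq> p"
proof -
  have "right_unique covered_by\<inverse>\<inverse>"
    by (auto simp: right_unique_def dest: covered_by_unique)
  moreover have "covered_by\<inverse>\<inverse>\<^sup>*\<^sup>* r p" "covered_by\<inverse>\<inverse>\<^sup>*\<^sup>* r q"
    using assms unfolding point_le_def rtranclp_conversep by auto
  ultimately have "covered_by\<inverse>\<inverse>\<^sup>*\<^sup>* p q \<or> covered_by\<inverse>\<inverse>\<^sup>*\<^sup>* q p"
    using single_valued_confluent[to_pred] by metis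
  then show ?thesis unfolding point_le_def rtranclp_conversep by auto
qed

lemma point_le_grid:
  assumes "p \<preceq> q" "q \<in> grid"
  shows "p \<in> grid"
  using assms unfolding point_le_def
  by (induction rule: converse_rtranclp_induct) (auto simp: grid_def elim!: covered_by.cases)

lemma finite_below: "finite {p. p \<preceq> q}"
  by (rule finite_subset[of _ "{..fst q} \<times> {..snd q}"]) (auto dest: point_le_coords)

section \<open>Convex shapes\<close>

definition order_convex :: "point set \<Rightarrow> bool" where
  "order_convex S \<longleftrightarrow> (\<forall>p\<in>S. \<forall>r\<in>S. \<forall>q. p \<preceq> q \<longrightarrow> q \<preceq> r \<longrightarrow> q \<in> S)"

lemma order_convexD: "order_convex S \<Longrightarrow> p \<in> S \<Longrightarrow> r \<in> S \<Longrightarrow> p \<preceq> q \<Longrightarrow> q \<preceq> r \<Longrightarrow> q \<in> S"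
  unfolding order_convex_def by blast

text \<open>Conversely, take for \<open>I\<close> the down-closure of \<open>S\<close>: a point of
  \<open>S\<close> below an element of \<open>I - S\<close> would, by convexity, force that element
  into \<open>S\<close>. This describes skew shapes without a choice of \<open>I\<close> and
  \<open>J\<close>.\<close>

lemma skew_ideal_iff: "skew_ideal S \<longleftrightarrow> finite S \<and> S \<subseteq> grid \<and> order_convex S"
proof
  assume "skew_ideal S"
  then show "finite S \<and> S \<subseteq> grid \<and> order_convex S"
    unfolding skew_ideal_def ideal_def order_convex_def by blast
next
  assume S: "finite S \<and> S \<subseteq> grid \<and> order_convex S"
  let ?I = "\<Union>s\<in>S. {p. p \<preceq> s}"
  have I: "ideal ?I"
    using S by (auto simp: ideal_def finite_below intro: point_le_grid point_le_trans)
  moreover have "ideal (?I - S)"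
    using S I by (auto simp: ideal_def dest: order_convexD intro: point_le_trans)
  ultimately show "skew_ideal S"
    unfolding skew_ideal_def by (intro exI[of _ ?I] exI[of _ "?I - S"]) auto
qed

section \<open>Slides without ambient ideals\<close>

text \<open>The rules \<open>one\<close> and \<open>two\<close> merge, since the inequality is
  vacuous for a single labelled cover. Only the hole and the labels occur, so a run does not depend
  on how the shape is written as a difference.\<close>

inductive sift_move ::
  "point \<times> (point \<rightharpoonup> 'a::linorder) \<Rightarrow> point \<times> (point \<rightharpoonup> 'a) \<Rightarrow> bool" where
  "H \<lessdot> K \<Longrightarrow> K \<in> dom f \<Longrightarrow>
    (\<And>L. H \<lessdot> L \<Longrightarrow> L \<in> dom f \<Longrightarrow> L \<noteq> K \<Longrightarrow> the (f K) < the (f L)) \<Longrightarrow>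
    sift_move (H, f) (K, f(H := f K, K := None))"

definition slide_at :: "point \<Rightarrow> (point \<rightharpoonup> 'a::linorder) \<Rightarrow> (point \<rightharpoonup> 'a) \<Rightarrow> bool" where
  "slide_at H f f' \<longleftrightarrow> (\<exists>K. sift_move\<^sup>*\<^sup>* (H, f) (K, f') \<and> (\<forall>L\<in>dom f'. \<not> K \<lessdot> L))"

text \<open>This replaces a maximal point of \<open>J\<close>. The existence clause excludes holes
  with no label above them, whose slide changes nothing, so that no step starts at an ideal.\<close>

definition inner_hole :: "(point \<rightharpoonup> 'a::linorder) \<Rightarrow> point \<Rightarrow> bool" where
  "inner_hole f H \<longleftrightarrow> H \<notin> dom f \<and> (\<exists>s\<in>dom f. H \<prec> s) \<and>
     (\<forall>s\<in>dom f. \<forall>q. H \<prec> q \<longrightarrow> q \<preceq> s \<longrightarrow> q \<in> dom f)"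

definition slide_step :: "(point \<rightharpoonup> 'a::linorder) \<Rightarrow> (point \<rightharpoonup> 'a) \<Rightarrow> bool" where
  "slide_step f f' \<longleftrightarrow> (\<exists>H. inner_hole f H \<and> slide_at H f f')"

text \<open>Of two different targets, each would carry the smaller label.\<close>

lemma sift_move_deterministic:
  assumes "sift_move s t" "sift_move s u"
  shows "t = u"
  using assms(1)
proof cases
  case (1 H K f)
  note t = this
  from assms(2) show ?thesis
  proof cases
    case (1 H' L f')
    then have eq: "H' = H" "f' = f" using t by auto
    have "K = L"
    proof (rule ccontr)
      assume "K \<noteq> L"
      then have "the (f K) < the (f L)" "the (f L) < the (f K)"
        using t 1 unfolding eq by auto
      then show False by simp
    qed
    then show ?thesis using t 1 eq by simp
  qed
qed

lemma slide_at_deterministic: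
  assumes "slide_at H f g" "slide_at H f h"
  shows "g = h"
proof -
  \<comment> \<open>A state whose hole has no labelled cover admits no move. Runs from one start are
    linearly ordered, so two such end states coincide.\<close>
  have final: "s = t" if "sift_move\<^sup>*\<^sup>* s t" "\<forall>L\<in>dom (snd s). \<not> fst s \<lessdot> L"
    for s t :: "point \<times> (point \<rightharpoonup> 'a)"
    using that(1)
  proof (cases rule: converse_rtranclpE)
    case (step u)
    from step(1) that(2) show ?thesis by cases auto
  qed simp
  have "right_unique (sift_move :: _ \<Rightarrow> point \<times> (point \<rightharpoonup> 'a) \<Rightarrow> bool)"
    by (auto simp: right_unique_def dest: sift_move_deterministic)
  note linear = single_valued_confluent[to_pred, OF this]
  from assms obtain K L where "sift_move\<^sup>*\<^sup>* (H, f) (K, g)" "\<forall>M\<in>dom g. \<not> K \<lessdot> M"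
    "sift_move\<^sup>*\<^sup>* (H, f) (L, h)" "\<forall>M\<in>dom h. \<not> L \<lessdot> M"
    unfolding slide_at_def by blast
  then have "(K, g) = (L, h)"
    using linear[of "(H, f)" "(K, g)" "(L, h)"] final[of "(K, g)" "(L, h)"]
      final[of "(L, h)" "(K, g)"] by auto
  then show ?thesis by simp
qed

text \<open>The hole only climbs, so every move reads and writes inside the up-set of
  \<open>H\<close>. The run can be replayed on any \<open>g\<close> that agrees with
  \<open>f\<close> there, leaving the rest of \<open>g\<close> untouched.\<close>

lemma sift_moves_local:
  assumes "sift_move\<^sup>*\<^sup>* (H, f) (K, f')" and "\<And>p. H \<preceq> p \<Longrightarrow> g p = f p"
  shows "H \<preceq> K \<and> (\<forall>p. \<not> H \<preceq> p \<longrightarrow> f' p = f p) \<and>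
    sift_move\<^sup>*\<^sup>* (H, g) (K, \<lambda>p. if H \<preceq> p then f' p else g p)"
  using assms(1)
proof (induction rule: rtranclp_induct2)
  case refl
  have "(\<lambda>p. if H \<preceq> p then f p else g p) = g" using assms(2) by auto
  then show ?case by simp
next
  case (step K f' L f'')
  let ?m = "\<lambda>h p. if H \<preceq> p then h p else g p"
  from step.hyps(2) have f'': "f'' = f'(K := f' L, L := None)" and cov: "K \<lessdot> L"
    and L: "L \<in> dom f'"
    and less: "\<And>M. K \<lessdot> M \<Longrightarrow> M \<in> dom f' \<Longrightarrow> M \<noteq> L \<Longrightarrow> the (f' L) < the (f' M)"
    by (auto elim: sift_move.cases)
  have up: "H \<preceq> M" if "K \<lessdot> M" for M
    using step.IH that covered_by_imp_le point_le_trans by blast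
  have "sift_move (K, ?m f') (L, (?m f')(K := ?m f' L, L := None))"
    using cov L less by (intro sift_move.intros) (auto simp: up dom_def)
  moreover have "(?m f')(K := ?m f' L, L := None) = ?m f''"
    using step.IH up[OF cov] by (auto simp: f'')
  ultimately show ?case
    using step.IH up[OF cov] by (auto simp: f'' intro: rtranclp.rtrancl_into_rtrancl)
qed

text \<open>Stopping is local as well: every cover of the final hole lies above
  \<open>H\<close>.\<close>

lemma slide_at_local:
  assumes "slide_at H f f'"
  shows "\<not> H \<preceq> p \<Longrightarrow> f' p = f p"
    and "(\<And>p. H \<preceq> p \<Longrightarrow> g p = f p) \<Longrightarrow> slide_at H g (\<lambda>p. if H \<preceq> p then f' p else g p)"
proof -
  from assms obtain K where K: "sift_move\<^sup>*\<^sup>* (H, f) (K, f')" "\<forall>L\<in>dom f'. \<not> K \<lessdot> L"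
    unfolding slide_at_def by blast
  show "\<not> H \<preceq> p \<Longrightarrow> f' p = f p"
    using sift_moves_local[OF K(1)] by blast
  assume "\<And>p. H \<preceq> p \<Longrightarrow> g p = f p"
  note loc = sift_moves_local[OF K(1) this]
  have "\<not> K \<lessdot> L" if "L \<in> dom (\<lambda>p. if H \<preceq> p then f' p else g p)" for L
  proof
    assume "K \<lessdot> L"
    then have "H \<preceq> L" using loc covered_by_imp_le point_le_trans by blast
    with that have "L \<in> dom f'" by (simp add: dom_def)
    with K(2) \<open>K \<lessdot> L\<close> show False by blast
  qed
  with loc show "slide_at H g (\<lambda>p. if H \<preceq> p then f' p else g p)"
    unfolding slide_at_def by blast
qed

section \<open>Confluence\<close>

text \<open>If \<open>H\<close> were below \<open>H'\<close>, a labelled point above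
  \<open>H'\<close> would put \<open>H'\<close> into the range that must be labelled for
  \<open>H\<close>.\<close>

lemma inner_holes_incomparable:
  assumes "inner_hole f H" "inner_hole f H'" "H \<noteq> H'"
  shows "\<not> H \<preceq> H'"
  using assms unfolding inner_hole_def point_less_def by blast

text \<open>All conditions on the hole concern the up-set of \<open>H\<close>, so the hole survives
  a slide at an incomparable hole.\<close>

lemma inner_hole_transfer:
  assumes "inner_hole f H" and eq: "\<And>p. H \<preceq> p \<Longrightarrow> g p = f p"
  shows "inner_hole g H"
proof -
  have dom: "p \<in> dom g \<longleftrightarrow> p \<in> dom f" if "H \<preceq> p" for p
    using eq[OF that] by (simp add: dom_def)
  have "q \<in> dom g" if "s \<in> dom g" "H \<prec> q" "q \<preceq> s" for s q
  proof -
    have "H \<preceq> q" "H \<preceq> s" using that point_le_trans unfolding point_less_def by blast+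
    then show ?thesis using assms(1) that dom unfolding inner_hole_def by blast
  qed
  moreover have "H \<notin> dom g" "\<exists>s\<in>dom g. H \<prec> s"
    using assms(1) dom point_le_refl unfolding inner_hole_def point_less_def by blast+
  ultimately show ?thesis unfolding inner_hole_def by blast
qed

lemma slide_step_diamond:
  assumes "slide_step f g" "slide_step f h"
  shows "g = h \<or> (\<exists>k. slide_step g k \<and> slide_step h k)"
proof -
  from assms obtain H H' where H: "inner_hole f H" "slide_at H f g"
    and H': "inner_hole f H'" "slide_at H' f h"
    unfolding slide_step_def by blast
  show ?thesis
  proof (cases "H = H'")
    case True
    with H H' slide_at_deterministic show ?thesis by blast
  next
    case False
    then have disj: "\<not> (H \<preceq> p \<and> H' \<preceq> p)" for p
      using inner_holes_incomparable[of f] H(1) H'(1) point_le_linear_below by metis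
    have g: "\<And>p. H' \<preceq> p \<Longrightarrow> g p = f p" and h: "\<And>p. H \<preceq> p \<Longrightarrow> h p = f p"
      using slide_at_local(1)[OF H(2)] slide_at_local(1)[OF H'(2)] disj by blast+
    \<comment> \<open>Both sides are the common result: \<open>g\<close> above \<open>H\<close>,
      \<open>h\<close> above \<open>H'\<close>, and \<open>f\<close> elsewhere, where neither slide
      acts.\<close>
    have "(\<lambda>p. if H' \<preceq> p then h p else g p) = (\<lambda>p. if H \<preceq> p then g p else h p)"
      using slide_at_local(1)[OF H(2)] slide_at_local(1)[OF H'(2)] disj by fastforce
    then show ?thesis
      using slide_at_local(2)[OF H(2), of h] slide_at_local(2)[OF H'(2), of g] g h
        inner_hole_transfer[OF H(1), of h] inner_hole_transfer[OF H'(1), of g]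
      unfolding slide_step_def by metis
  qed
qed

text \<open>Strong confluence allows at most one step on one side of the peak; the one-step diamond
  and the case \<open>g = h\<close> both fit.\<close>

lemma slide_step_confluent: "confluentp slide_step"
proof (rule strong_confluentp_imp_confluentp, rule strong_confluentpI)
  fix f g h :: "point \<rightharpoonup> 'a"
  assume "slide_step f g" "slide_step f h"
  then show "\<exists>k. slide_step\<^sup>*\<^sup>* g k \<and> slide_step\<^sup>=\<^sup>= h k"
    using slide_step_diamond by blast
qed

lemma slide_step_normal_form:
  assumes "ideal (dom f)" "slide_step\<^sup>*\<^sup>* f g"
  shows "g = f"
  using assms(2)
proof (cases rule: converse_rtranclpE)
  case (step h)
  then obtain H s where "H \<notin> dom f" "s \<in> dom f" "H \<prec> s"
    unfolding slide_step_def inner_hole_def by blast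
  with assms(1) show ?thesis unfolding ideal_def point_less_def by blast
qed simp

section \<open>Jeu de taquin consists of slide steps\<close>

text \<open>Invariant: the hole and the labelled points together fill \<open>I - J\<close>. Hence
  the covers inspected by \<open>downward_move\<close> are exactly the labelled covers of the
  hole.\<close>

lemma downward_moves_imp_sift_moves:
  assumes "(downward_move I J)\<^sup>*\<^sup>* (H, f) (K, f')" "H \<notin> dom f" "insert H (dom f) = I - J"
  shows "sift_move\<^sup>*\<^sup>* (H, f) (K, f') \<and> K \<notin> dom f' \<and> insert K (dom f') = I - J"
  using assms(1)
proof (induction rule: rtranclp_induct2)
  case refl
  with assms(2,3) show ?case by simp
next
  case (step K f' L f'')
  from step.IH have K: "K \<notin> dom f'" "insert K (dom f') = I - J" by auto
  have "M \<noteq> K" if "K \<lessdot> M" for M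
    using covered_by_imp_less[OF that] by (auto simp: point_less_def)
  then have covers: "covers_in (I - J) K = {M \<in> dom f'. K \<lessdot> M}"
    unfolding covers_in_def K(2)[symmetric] by auto
  from step.hyps(2) have "f'' = f'(K := f' L, L := None) \<and> L \<in> dom f' \<and> K \<lessdot> L \<and>
    (\<forall>M. K \<lessdot> M \<longrightarrow> M \<in> dom f' \<longrightarrow> M \<noteq> L \<longrightarrow> the (f' L) < the (f' M))"
    (is "_ \<and> _ \<and> ?cov \<and> ?less")
  proof cases
    case one
    then show ?thesis using covers by auto
  next
    case (two M x y)
    then have "{N \<in> dom f'. K \<lessdot> N} = {L, M}" using covers by simp
    moreover from this have "K \<lessdot> L" by blast
    ultimately show ?thesis using two by auto
  qed
  then have L: "f'' = f'(K := f' L, L := None)" "L \<in> dom f'" and "?cov" "?less" by blast+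
  then have move: "sift_move (K, f') (L, f'')"
    unfolding L(1) by (intro sift_move.intros) blast+
  have "L \<noteq> K" using L(2) K(1) by blast
  then have "L \<notin> dom f''" "insert L (dom f'') = insert K (dom f')"
    using L(1,2) by (auto simp: dom_def)
  with move K step.IH show ?case by (auto intro: rtranclp.rtrancl_into_rtrancl)
qed

text \<open>The reflexive closure absorbs slides from a maximal point of \<open>J\<close> with no
  label above it.\<close>

lemma downward_slide_imp_slide_step:
  assumes "downward_slide R R'"
  shows "slide_step\<^sup>=\<^sup>= R R'"
proof -
  from assms obtain I J H K where I: "ideal I" and J: "ideal J" "J \<subseteq> I" and R: "dom R = I - J"
    and H: "maximal_in J H" and moves: "(downward_move I (J - {H}))\<^sup>*\<^sup>* (H, R) (K, R')"
    and K: "upper_corner I K"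
    unfolding downward_slide_def by blast
  have "H \<in> J" using H by (simp add: maximal_in_def)
  then have "H \<notin> dom R" "insert H (dom R) = I - (J - {H})" using R J(2) by auto
  note sift = downward_moves_imp_sift_moves[OF moves this]
  \<comment> \<open>A labelled point covering \<open>K\<close> lies in the ideal
    \<open>I - {K}\<close>, which would then contain \<open>K\<close>.\<close>
  have "\<not> K \<lessdot> L" if "L \<in> dom R'" for L
  proof
    assume "K \<lessdot> L"
    moreover have "L \<in> I - {K}" using sift that by auto
    ultimately show False
      using K covered_by_imp_le unfolding upper_corner_def ideal_def by blast
  qed
  with sift have at: "slide_at H R R'" unfolding slide_at_def by blast
  show ?thesis
  proof (cases "\<exists>s\<in>dom R. H \<prec> s")
    case True
    \<comment> \<open>\<open>q\<close> lies in \<open>I\<close> because \<open>s\<close> does, and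
      outside \<open>J\<close> because \<open>H\<close> is maximal in \<open>J\<close>.\<close>
    have "q \<in> dom R" if "s \<in> dom R" "H \<prec> q" "q \<preceq> s" for q s
      using that R I H unfolding ideal_def maximal_in_def by blast
    with True \<open>H \<notin> dom R\<close> have "inner_hole R H" unfolding inner_hole_def by blast
    with at show ?thesis unfolding slide_step_def by blast
  next
    case False
    \<comment> \<open>The empty run already stops here, so determinism gives
      \<open>R' = R\<close>.\<close>
    then have "slide_at H R R"
      unfolding slide_at_def using covered_by_imp_less by blast
    with at slide_at_deterministic show ?thesis by blast
  qed
qed

lemma downward_jdt_imp_slide_steps:
  "downward_jdt R P \<Longrightarrow> slide_step\<^sup>*\<^sup>* R P \<and> ideal (dom P)"
proof (induction rule: downward_jdt.induct)
  case (slide R R' P)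
  then show ?case using downward_slide_imp_slide_step[OF slide.hyps(2)]
    by (auto intro: converse_rtranclp_into_rtranclp)
qed simp

section \<open>Slides preserve skew partitions\<close>

definition holed_labelling :: "'a::linorder set \<Rightarrow> point \<Rightarrow> (point \<rightharpoonup> 'a) \<Rightarrow> bool" where
  "holed_labelling A H f \<longleftrightarrow> H \<in> grid \<and> H \<notin> dom f \<and> order_convex (insert H (dom f)) \<and>
     labelling A (dom f) f"

text \<open>\<open>H\<close> receives the least label among its labelled covers, so labels still
  increase upwards from \<open>H\<close>; points below \<open>H\<close> are also below
  \<open>K\<close>, so their labels were already smaller. The shape together with its hole stays the
  same set.\<close>

lemma sift_move_holed_labelling:
  assumes "sift_move (H, f) (K, f')" "holed_labelling A H f"
  shows "holed_labelling A K f'"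
proof -
  from assms(1) have f': "f' = f(H := f K, K := None)" and cov: "H \<lessdot> K" and K: "K \<in> dom f"
    and less: "\<And>L. H \<lessdot> L \<Longrightarrow> L \<in> dom f \<Longrightarrow> L \<noteq> K \<Longrightarrow> the (f K) < the (f L)"
    by (auto elim: sift_move.cases)
  from assms(2) have H: "H \<in> grid" "H \<notin> dom f" and conv: "order_convex (insert H (dom f))"
    and lab: "labelling A (dom f) f"
    by (auto simp: holed_labelling_def)
  have mono: "\<And>p q. p \<in> dom f \<Longrightarrow> q \<in> dom f \<Longrightarrow> p \<prec> q \<Longrightarrow> the (f p) < the (f q)"
    and inj: "inj_on f (dom f)" and ran: "ran f \<subseteq> A" and fin: "finite (dom f)"
    and grid: "dom f \<subseteq> grid"
    using lab by (auto simp: labelling_def)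
  have "H \<noteq> K" using H(2) K by blast
  have dom: "dom f' = insert H (dom f - {K})"
    using f' K \<open>H \<noteq> K\<close> by (auto simp: dom_def)
  have val: "f' p = (if p = H then f K else f p)" if "p \<in> dom f'" for p
    using that f' dom \<open>H \<noteq> K\<close> by auto
  have "the (f' p) < the (f' q)" if p: "p \<in> dom f'" and q: "q \<in> dom f'" and "p \<prec> q" for p q
  proof -
    consider "p = H" | "q = H" "p \<noteq> H" | "p \<noteq> H" "q \<noteq> H" by blast
    then show ?thesis
    proof cases
      case 1
      with \<open>p \<prec> q\<close> have "q \<noteq> H" by (auto simp: point_less_def)
      with q dom have q': "q \<in> dom f" "q \<noteq> K" by auto
      \<comment> \<open>\<open>L\<close> is the first point on the way from \<open>H\<close> up to
        \<open>q\<close>; its label is at least that of \<open>K\<close> and at most that of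
        \<open>q\<close>.\<close>
      from point_less_imp_cover[OF \<open>p \<prec> q\<close>] 1
      obtain L where L: "H \<lessdot> L" "L \<preceq> q" by blast
      have "L \<noteq> H" using covered_by_imp_less[OF L(1)] by (auto simp: point_less_def)
      then have "L \<in> dom f"
        using order_convexD[OF conv _ _ covered_by_imp_le[OF L(1)] L(2)] q' by blast
      then have "L = K \<or> the (f K) < the (f L)" "L = q \<or> the (f L) < the (f q)"
        using less[OF L(1)] mono[of L q] L(2) q' by (auto simp: point_less_def)
      then have "the (f K) < the (f q)" using q' by auto
      then show ?thesis using val[OF p] val[OF q] 1 \<open>q \<noteq> H\<close> by simp
    next
      case 2
      then have "p \<in> dom f" "p \<noteq> K" using p dom by auto
      moreover have "p \<prec> K"
        using \<open>p \<prec> q\<close> 2 cov \<open>p \<noteq> K\<close> covered_by_imp_le point_le_trans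
        unfolding point_less_def by blast
      ultimately show ?thesis using mono[OF _ K] val[OF p] val[OF q] 2 by auto
    next
      case 3
      then show ?thesis using mono[OF _ _ \<open>p \<prec> q\<close>] val[OF p] val[OF q] p q dom by auto
    qed
  qed
  moreover have "inj_on f' (dom f')"
  proof (rule inj_onI)
    fix p q assume "p \<in> dom f'" "q \<in> dom f'" "f' p = f' q"
    then have "(if p = H then f K else f p) = (if q = H then f K else f q)"
      using val by metis
    \<comment> \<open>\<open>K\<close> has lost its label, so the label now at \<open>H\<close>
      occurs nowhere else.\<close>
    moreover have "p = H \<or> p \<in> dom f \<and> p \<noteq> K" "q = H \<or> q \<in> dom f \<and> q \<noteq> K"
      using \<open>p \<in> dom f'\<close> \<open>q \<in> dom f'\<close> dom by auto
    ultimately show "p = q"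
      using inj_onD[OF inj _ _ K] inj_onD[OF inj, of p q] by metis
  qed
  moreover have "ran f' \<subseteq> A"
  proof
    fix a assume "a \<in> ran f'"
    then obtain p where "p \<in> dom f'" "f' p = Some a" by (auto simp: ran_def)
    then have "f K = Some a \<or> f p = Some a" using val by metis
    then show "a \<in> A" using ran ranI by fast
  qed
  ultimately have "labelling A (dom f') f'"
    unfolding labelling_def using fin grid H(1) dom by auto
  moreover have "insert K (dom f') = insert H (dom f)" using dom K by auto
  ultimately show ?thesis
    using conv grid K f' unfolding holed_labelling_def by auto
qed

lemma slide_step_skew_partition:
  assumes "slide_step R R'" "skew_partition A R"
  shows "skew_partition A R'"
proof -
  from assms(1) obtain H K where H: "inner_hole R H" and moves: "sift_move\<^sup>*\<^sup>* (H, R) (K, R')"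
    and K: "\<forall>L\<in>dom R'. \<not> K \<lessdot> L"
    unfolding slide_step_def slide_at_def by blast
  from assms(2) have R: "order_convex (dom R)" "dom R \<subseteq> grid" "labelling A (dom R) R"
    by (auto simp: skew_partition_def skew_ideal_iff)
  from H obtain s where s: "s \<in> dom R" "H \<prec> s" unfolding inner_hole_def by blast
  \<comment> \<open>Otherwise \<open>H\<close> would lie between two labelled points and be labelled
    by convexity.\<close>
  have below: "\<not> p \<preceq> H" if "p \<in> dom R" for p
    using order_convexD[OF R(1) that s(1)] s(2) H unfolding inner_hole_def point_less_def by blast
  have "order_convex (insert H (dom R))"
    unfolding order_convex_def
  proof (intro ballI allI impI)
    fix p r q assume "p \<in> insert H (dom R)" "r \<in> insert H (dom R)" "p \<preceq> q" "q \<preceq> r"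
    then consider "p = H" "r = H" | "p = H" "r \<in> dom R" | "p \<in> dom R" "r = H"
      | "p \<in> dom R" "r \<in> dom R" by blast
    then show "q \<in> insert H (dom R)"
    proof cases
      case 1
      with \<open>p \<preceq> q\<close> \<open>q \<preceq> r\<close> point_le_antisym show ?thesis by blast
    next
      case 2
      with H \<open>p \<preceq> q\<close> \<open>q \<preceq> r\<close> show ?thesis unfolding inner_hole_def point_less_def by blast
    next
      case 3
      with below \<open>p \<preceq> q\<close> \<open>q \<preceq> r\<close> point_le_trans show ?thesis by blast
    next
      case 4
      with order_convexD[OF R(1)] \<open>p \<preceq> q\<close> \<open>q \<preceq> r\<close> show ?thesis by blast
    qed
  qed
  moreover have "H \<in> grid" using s R(2) point_le_grid unfolding point_less_def by blast
  ultimately have "holed_labelling A H R"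
    using H R(3) unfolding holed_labelling_def inner_hole_def by blast
  with moves have hl: "holed_labelling A K R'"
    by (induction rule: rtranclp_induct2) (auto intro: sift_move_holed_labelling)
  have "q \<in> dom R'" if pr: "p \<in> dom R'" "r \<in> dom R'" and le: "p \<preceq> q" "q \<preceq> r" for p q r
  proof -
    have q: "q \<in> insert K (dom R')"
      using hl pr le order_convexD[of "insert K (dom R')" p r q]
      unfolding holed_labelling_def by blast
    \<comment> \<open>The first step from \<open>K\<close> towards \<open>r\<close> would reach a
      labelled cover of \<open>K\<close>, contrary to the stopping condition. Hence \<open>q\<close>
      cannot be \<open>K\<close>.\<close>
    have "\<not> K \<prec> r"
    proof
      assume "K \<prec> r"
      then obtain L where L: "K \<lessdot> L" "L \<preceq> r" using point_less_imp_cover by blast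
      then have "L \<in> insert K (dom R')"
        using hl pr order_convexD[of "insert K (dom R')" K r L] covered_by_imp_le
        unfolding holed_labelling_def by blast
      with L(1) K covered_by_imp_less[OF L(1)] show False by (auto simp: point_less_def)
    qed
    then show ?thesis
      using q pr le hl unfolding holed_labelling_def point_less_def by blast
  qed
  then have "order_convex (dom R')" unfolding order_convex_def by blast
  then show ?thesis
    using hl unfolding holed_labelling_def skew_partition_def skew_ideal_iff labelling_def by blast
qed

theorem theorem9p3:
  fixes A :: "'a::linorder set" and R P Q :: "point \<rightharpoonup> 'a"
  assumes "finite A"
    and "skew_partition A R"
    and "downward_jdt R P"
    and "downward_jdt R Q"
  shows "is_partition A P \<and> P = Q"
proof
  have P: "slide_step\<^sup>*\<^sup>* R P" "ideal (dom P)" and Q: "slide_step\<^sup>*\<^sup>* R Q" "ideal (dom Q)"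
    using assms(3,4) downward_jdt_imp_slide_steps by blast+
  from P(1) assms(2) have "skew_partition A P"
    by (induction rule: rtranclp_induct) (auto intro: slide_step_skew_partition)
  with P(2) show "is_partition A P" by (simp add: is_partition_def skew_partition_def)
  \<comment> \<open>Confluence gives a common reduct, and both ideals, being normal forms, equal
    it.\<close>
  show "P = Q"
    using confluentpD[OF slide_step_confluent P(1) Q(1)] slide_step_normal_form P(2) Q(2)
    by metis
qed

end
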